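(* Let $(S,\mathit{Tr},\mathrm{source},\mathrm{target},\ell,\smile^{\bullet})$ be a labelled transition system with concurrency, and let $B$ be a set of actions with $\mathit{Rec}\subseteq B\subseteq \mathit{Act}$. Suppose that for every state $s\in S$ only countably many transitions $t\in \mathit{Tr}^\bullet_{\neg B}$ satisfy $\mathrm{source}(t)=s$. Then $B$-justness is feasible: every finite path is a prefix of some $B$-just path.
   Context: A labelled transition system (LTS) is a tuple $(S,\mathit{Tr},\mathrm{source},\mathrm{target},\ell)$ with $S$ a set of states, $\mathit{Tr}$ a set of transitions, $\mathrm{source},\mathrm{target}:\mathit{Tr}\to S$ and $\ell:\mathit{Tr}\to\mathit{Lab}$, where the label set comes with subsets $\mathit{Rec}\subseteq\mathit{Act}\subseteq\mathit{Lab}$ (actions and receptive actions). Transitions $t$ with $\ell(t)\notin\mathit{Act}$ are called indicator transitions. Let $\mathit{Tr}^\bullet=\{t\in\mathit{Tr}\mid \ell(t)\in\mathit{Act}\setminus\mathit{Rec}\}$ and, for $\mathit{Rec}\subseteq B\subseteq\mathit{Act}$, $\mathit{Tr}^\bullet_{\neg B}=\{t\in\mathit{Tr}^\bullet\mid \ell(t)\notin B\}$. A path is an alternating sequence $s_0\,t_1\,s_1\,t_2\,s_2\cdots$ of states and non-indicator transitions, starting with a state and either infinite or ending with a state, with $\mathrm{source}(t_i)=s_{i-1}$ and $\mathrm{target}(t_i)=s_i$. An LTS with concurrency (LTSC) is an LTS together with a relation $\smile^{\bullet}\subseteq\mathit{Tr}^\bullet\times\mathit{Tr}$ such that (1) $t\not\smile^{\bullet}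 t$ for all $t\in\mathit{Tr}^\bullet$, and (2) if $t\in\mathit{Tr}^\bullet$ and $\pi$ is a path from $\mathrm{source}(t)$ to a state $s$ such that $t\smile^{\bullet} v$ for all transitions $v$ occurring in $\pi$, then there is $u\in\mathit{Tr}^\bullet$ with $\mathrm{source}(u)=s$, $\ell(u)=\ell(t)$ and $t\not\smile^{\bullet} u$. A path $\pi$ is $B$-just if for each suffix $\pi'$ of $\pi$ and each $t\in\mathit{Tr}^\bullet_{\neg B}$ whose source is the first state of $\pi'$, some transition $u$ with $t\not\smile^{\bullet}u$ occurs in $\pi'$. *)

theory Defs
  imports "HOL-Library.Countable_Set"
begin

record ('s, 't, 'l) lts =
  states :: "'s set"
  transitions :: "'t set"
  source :: "'t \<Rightarrow> 's"
  target :: "'t \<Rightarrow> 's"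
  label :: "'t \<Rightarrow> 'l"
  labels :: "'l set"
  actions :: "'l set"
  receptive :: "'l set"

locale labelled_transition_system =
  fixes L :: "('s, 't, 'l, 'x) lts_scheme"
  assumes source_in_states: "t \<in> transitions L \<Longrightarrow> source L t \<in> states L"
    and target_in_states: "t \<in> transitions L \<Longrightarrow> target L t \<in> states L"
    and label_in_labels: "t \<in> transitions L \<Longrightarrow> label L t \<in> labels L"
    and receptive_subset_actions: "receptive L \<subseteq> actions L"
    and actions_subset_labels: "actions L \<subseteq> labels L"

(* The sets written Tr^bullet and Tr^bullet_{not B}. *)
definition active :: "('s, 't, 'l, 'x) lts_scheme \<Rightarrow> 't set" where
  "active L = {t \<in> transitions L. label L t \<in> actions L - receptive L}"

definition nonblocked :: "('s, 't, 'l, 'x) lts_scheme \<Rightarrow> 'l set \<Rightarrow> 't set" where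
  "nonblocked L B = {t \<in> active L. label L t \<notin> B}"

(* Alternating sequences of states and transitions that start with a state and are either
   infinite or end with a state.  Being a codatatype, the type contains the infinite sequences;
   seq_transitions yields the set of transitions occurring in a sequence. *)
codatatype (seq_states: 's, seq_transitions: 't) altseq =
    End (first: 's)
  | Step (first: 's) 't "('s, 't) altseq"

coinductive is_path :: "('s, 't, 'l, 'x) lts_scheme \<Rightarrow> ('s, 't) altseq \<Rightarrow> bool"
  for L :: "('s, 't, 'l, 'x) lts_scheme" where
  is_path_End: "s \<in> states L \<Longrightarrow> is_path L (End s)"
| is_path_Step: "\<lbrakk>s \<in> states L; t \<in> transitions L; label L t \<in> actions L;
     source L t = s; target L t = first p; is_path L p\<rbrakk> \<Longrightarrow> is_path L (Step s t p)"

(* The sequence is finite, with the given last state. *)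
inductive ends_in :: "('s, 't) altseq \<Rightarrow> 's \<Rightarrow> bool" where
  ends_in_End: "ends_in (End s) s"
| ends_in_Step: "ends_in p s' \<Longrightarrow> ends_in (Step s t p) s'"

definition finite_seq :: "('s, 't) altseq \<Rightarrow> bool" where
  "finite_seq p \<longleftrightarrow> (\<exists>s. ends_in p s)"

(* Prefixes and suffixes are again alternating sequences, so they are cut off at states.
   is_suffix q p: q is a suffix of p;  is_prefix q p: q is a prefix of p. *)
inductive is_suffix :: "('s, 't) altseq \<Rightarrow> ('s, 't) altseq \<Rightarrow> bool" where
  is_suffix_refl: "is_suffix p p"
| is_suffix_Step: "is_suffix q p \<Longrightarrow> is_suffix q (Step s t p)"

(* Coinductive, so that an infinite sequence is a prefix of itself. *)
coinductive is_prefix :: "('s, 't) altseq \<Rightarrow> ('s, 't) altseq \<Rightarrow> bool" where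
  is_prefix_End: "first p = s \<Longrightarrow> is_prefix (End s) p"
| is_prefix_Step: "is_prefix q p \<Longrightarrow> is_prefix (Step s t q) (Step s t p)"

record ('s, 't, 'l) ltsc = "('s, 't, 'l) lts" +
  conc :: "('t \<times> 't) set"

locale lts_with_concurrency = labelled_transition_system L
  for L :: "('s, 't, 'l, 'x) ltsc_scheme" +
  assumes conc_subset: "conc L \<subseteq> active L \<times> transitions L"
    and conc_irrefl: "t \<in> active L \<Longrightarrow> (t, t) \<notin> conc L"
    and conc_closed:
      "\<lbrakk>t \<in> active L; is_path L p; first p = source L t; ends_in p s;
        \<And>v. v \<in> seq_transitions p \<Longrightarrow> (t, v) \<in> conc L\<rbrakk>
       \<Longrightarrow> \<exists>u \<in> active L. source L u = s \<and> label L u = label L t \<and> (t, u) \<notin> conc L"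

definition just :: "('s, 't, 'l, 'x) ltsc_scheme \<Rightarrow> 'l set \<Rightarrow> ('s, 't) altseq \<Rightarrow> bool" where
  "just L B p \<longleftrightarrow> is_path L p \<and>
     (\<forall>q t. is_suffix q p \<and> t \<in> nonblocked L B \<and> source L t = first q \<longrightarrow>
        (\<exists>u \<in> seq_transitions q. (t, u) \<notin> conc L))"

definition feasible ::
    "('s, 't, 'l, 'x) lts_scheme \<Rightarrow> (('s, 't) altseq \<Rightarrow> bool) \<Rightarrow> bool" where
  "feasible L P \<longleftrightarrow>
     (\<forall>p. is_path L p \<and> finite_seq p \<longrightarrow> (\<exists>p'. is_path L p' \<and> is_prefix p p' \<and> P p'))"

end

theory Submission
  imports Defs
begin

text \<open>
  A task is a pair of a position on a path and a nonblocked transition enabled there; it is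
  discharged once a later transition of the path fails to be concurrent with it. By the closure
  condition on concurrency, an undischarged task of a finite path can always be discharged by
  appending a single transition. If no finite extension of the given path is just, keep discharging
  the undischarged task of least code, for an injective numbering of tasks by naturals.
  No task is selected twice, and only finitely many codes lie below a given one, so no task of the
  resulting infinite path stays undischarged forever.
\<close>

section \<open>Sequences given by their transitions\<close>

primrec fin_seq :: "('t \<Rightarrow> 's) \<Rightarrow> 's \<Rightarrow> 't list \<Rightarrow> ('s, 't) altseq" where
  "fin_seq tgt s [] = End s"
| "fin_seq tgt s (t # ts) = Step s t (fin_seq tgt (tgt t) ts)"

definition end_state :: "('t \<Rightarrow> 's) \<Rightarrow> 's \<Rightarrow> 't list \<Rightarrow> 's" where
  "end_state tgt s ts = last (s # map tgt ts)"

text \<open>The start index is an argument so that every suffix is again of the form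
  \<open>inf_seq src f i\<close>.\<close>

primcorec inf_seq :: "('t \<Rightarrow> 's) \<Rightarrow> (nat \<Rightarrow> 't) \<Rightarrow> nat \<Rightarrow> ('s, 't) altseq" where
  "inf_seq src f n = Step (src (f n)) (f n) (inf_seq src f (Suc n))"

lemma end_state_simps [simp]:
  "end_state tgt s [] = s"
  "end_state tgt s (t # ts) = end_state tgt (tgt t) ts"
  "end_state tgt s (ts @ [t]) = tgt t"
  by (auto simp: end_state_def)

lemma end_state_append: "end_state tgt s (xs @ ys) = end_state tgt (end_state tgt s xs) ys"
  by (induction xs arbitrary: s) auto

lemma first_fin_seq [simp]: "first (fin_seq tgt s ts) = s"
  by (cases ts) auto

lemma first_inf_seq [simp]: "first (inf_seq src f n) = src (f n)"
  by (subst inf_seq.code) simp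

lemma seq_transitions_fin_seq [simp]: "seq_transitions (fin_seq tgt s ts) = set ts"
  by (induction ts arbitrary: s) auto

lemma seq_transitions_inf_seq:
  assumes "n \<le> k"
  shows "f k \<in> seq_transitions (inf_seq src f n)"
  using assms
proof (induction rule: inc_induct)
  case base
  show ?case by (subst inf_seq.code) simp
next
  case (step m)
  then show ?case by (subst inf_seq.code) simp
qed

lemma ends_in_fin_seq: "ends_in (fin_seq tgt s ts) (end_state tgt s ts)"
  by (induction ts arbitrary: s) (auto intro: ends_in.intros)

lemma is_path_End_iff [simp]: "is_path L (End s) \<longleftrightarrow> s \<in> states L"
  by (auto elim: is_path.cases intro: is_path.intros)

lemma is_path_Step_iff [simp]:
  "is_path L (Step s t p) \<longleftrightarrow> s \<in> states L \<and> t \<in> transitions L \<and> label L t \<in> actions L \<and>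
     source L t = s \<and> target L t = first p \<and> is_path L p"
  by (auto elim: is_path.cases intro: is_path.intros)

lemma finite_path_eq_fin_seq:
  assumes "ends_in p s'" "is_path L p"
  shows "\<exists>ts. p = fin_seq (target L) (first p) ts"
  using assms
proof (induction rule: ends_in.induct)
  case (ends_in_End s)
  show ?case by (rule exI[of _ "[]"]) simp
next
  case (ends_in_Step p s' s t)
  then obtain ts where "p = fin_seq (target L) (first p) ts" by auto
  then show ?case using ends_in_Step.prems by (intro exI[of _ "t # ts"]) simp
qed

lemma is_suffix_fin_seq:
  assumes "is_suffix q (fin_seq tgt s ts)"
  shows "\<exists>i\<le>length ts. q = fin_seq tgt (end_state tgt s (take i ts)) (drop i ts)"
  using assms
proof (induction ts arbitrary: s)
  case Nil
  then show ?case by (auto elim: is_suffix.cases)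
next
  case (Cons t ts)
  from Cons.prems consider "q = fin_seq tgt s (t # ts)" | "is_suffix q (fin_seq tgt (tgt t) ts)"
    by (auto elim: is_suffix.cases)
  then show ?case
  proof cases
    case 1
    then show ?thesis by (intro exI[of _ 0]) simp
  next
    case 2
    from Cons.IH[OF this] obtain i where
      "i \<le> length ts" "q = fin_seq tgt (end_state tgt (tgt t) (take i ts)) (drop i ts)" by auto
    then show ?thesis by (intro exI[of _ "Suc i"]) simp
  qed
qed

lemma is_suffix_inf_seq:
  assumes "is_suffix q (inf_seq src f n)"
  shows "\<exists>i\<ge>n. q = inf_seq src f i"
  using assms
proof (induction q "inf_seq src f n" arbitrary: n rule: is_suffix.induct)
  case is_suffix_refl
  then show ?case by auto
next
  case (is_suffix_Step q p s t)
  from is_suffix_Step.hyps(3) have "p = inf_seq src f (Suc n)" by (subst (asm) inf_seq.code) simp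
  from is_suffix_Step.hyps(2)[OF this] show ?case using Suc_leD by blast
qed

lemma is_prefix_fin_seq: "is_prefix (fin_seq tgt s xs) (fin_seq tgt s (xs @ ys))"
  by (induction xs arbitrary: s) (auto intro: is_prefix.intros)

text \<open>\<open>fin_seq\<close> takes its later states from targets, \<open>inf_seq\<close> takes
  all states from sources; the last assumption reconciles the two.\<close>

lemma is_prefix_inf_seq:
  assumes "first (inf_seq src f n) = s"
    and "\<And>k. k < length xs \<Longrightarrow> f (n + k) = xs ! k"
    and "\<And>k. src (f (Suc k)) = tgt (f k)"
  shows "is_prefix (fin_seq tgt s xs) (inf_seq src f n)"
  using assms(1,2)
proof (induction xs arbitrary: s n)
  case Nil
  then show ?case by (auto intro: is_prefix.intros)
next
  case (Cons t ts)
  have "f n = t" using Cons.prems(2)[of 0] by simp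
  moreover have "is_prefix (fin_seq tgt (tgt t) ts) (inf_seq src f (Suc n))"
    using Cons.prems(2)[of "Suc k" for k] \<open>f n = t\<close> by (intro Cons.IH) (auto simp: assms(3))
  ultimately show ?case using Cons.prems(1) by (subst inf_seq.code) (auto intro: is_prefix.intros)
qed

lemma is_path_inf_seq:
  assumes "\<And>k. f k \<in> transitions L \<and> label L (f k) \<in> actions L \<and> source L (f k) \<in> states L"
    and "\<And>k. source L (f (Suc k)) = target L (f k)"
  shows "is_path L (inf_seq (source L) f n)"
proof -
  \<comment> \<open>Coinduction needs a property closed under tails, hence all start indices at
    once.\<close>
  have "\<exists>n. p = inf_seq (source L) f n \<Longrightarrow> is_path L p" for p
  proof (coinduction arbitrary: p rule: is_path.coinduct)
    case is_path
    then obtain n where n: "p = Step (source L (f n)) (f n) (inf_seq (source L) f (Suc n))"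
      using inf_seq.code by metis
    show ?case
      by (rule disjI2) (use n assms in auto)
  qed
  then show ?thesis by blast
qed

section \<open>Tasks and their codes\<close>

text \<open>The undischarged tasks. The position is recorded because a transition enabled again
  later is a new obligation. The last state poses tasks too, hence \<open>i = length xs\<close> is
  allowed.\<close>

definition pending ::
    "('s, 't, 'l, 'x) ltsc_scheme \<Rightarrow> 'l set \<Rightarrow> 's \<Rightarrow> 't list \<Rightarrow> nat \<times> 't \<Rightarrow> bool" where
  "pending L B s xs = (\<lambda>(i, t). i \<le> length xs \<and> t \<in> nonblocked L B \<and>
     source L t = end_state (target L) s (take i xs) \<and> (\<forall>v \<in> set (drop i xs). (t, v) \<in> conc L))"

text \<open>Countability is given only for the transitions leaving one state, so \<open>t\<close> is
  numbered among those with its source.\<close>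

definition task_code :: "('s, 't, 'l, 'x) ltsc_scheme \<Rightarrow> 'l set \<Rightarrow> nat \<times> 't \<Rightarrow> nat" where
  "task_code L B = (\<lambda>(i, t).
     prod_encode (i, to_nat_on {t' \<in> nonblocked L B. source L t' = source L t} t))"

text \<open>
  The code of a transition only numbers it among those with the same source, so injectivity needs a
  fixed source for each position.
\<close>

lemma task_code_eqD:
  assumes "task_code L B (i, t) = task_code L B (j, t')"
    and "t \<in> nonblocked L B" "t' \<in> nonblocked L B"
    and "i = j \<Longrightarrow> source L t = source L t'"
    and "countable {t' \<in> nonblocked L B. source L t' = source L t}"
  shows "(i, t) = (j, t')"
  using assms by (auto simp: task_code_def)

text \<open>Course-of-values recursion: beyond \<open>xs\<close>, each transition is chosen by
  \<open>g\<close> from the list of all earlier ones.\<close>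

fun history_rec :: "'t list \<Rightarrow> ('t list \<Rightarrow> 't) \<Rightarrow> nat \<Rightarrow> 't" where
  "history_rec xs g k = (if k < length xs then xs ! k else g (map (history_rec xs g) [0..<k]))"

declare history_rec.simps [simp del]

section \<open>Greedy discharge of tasks\<close>

context lts_with_concurrency
begin

lemma is_path_fin_seq_snoc:
  "is_path L (fin_seq (target L) s (xs @ [u])) \<longleftrightarrow>
     is_path L (fin_seq (target L) s xs) \<and> u \<in> transitions L \<and> label L u \<in> actions L \<and>
     source L u = end_state (target L) s xs"
  by (induction xs arbitrary: s) (auto intro: target_in_states source_in_states)

lemma is_path_fin_seq_append:
  "is_path L (fin_seq (target L) s (xs @ ys)) \<longleftrightarrow>
     is_path L (fin_seq (target L) s xs) \<and>
     is_path L (fin_seq (target L) (end_state (target L) s xs) ys)"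
proof (induction ys rule: rev_induct)
  case Nil
  show ?case by (induction xs arbitrary: s) auto
next
  case (snoc u ys)
  then show ?case
    by (auto simp: is_path_fin_seq_snoc end_state_append simp flip: append_assoc)
qed

text \<open>A suffix violating justness starts at some position \<open>i\<close>; with the
  undischarged \<open>t\<close> enabled there it gives the task \<open>(i, t)\<close>.\<close>

lemma not_just_fin_seqE:
  assumes "is_path L (fin_seq (target L) s xs)" "\<not> just L B (fin_seq (target L) s xs)"
  obtains a where "pending L B s xs a"
proof -
  obtain q t where q: "is_suffix q (fin_seq (target L) s xs)" "t \<in> nonblocked L B"
    "source L t = first q" "\<forall>u \<in> seq_transitions q. (t, u) \<in> conc L"
    using assms unfolding just_def by blast
  from is_suffix_fin_seq[OF q(1)] obtain i where
    "i \<le> length xs" "q = fin_seq (target L) (end_state (target L) s (take i xs)) (drop i xs)"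
    by auto
  then have "pending L B s xs (i, t)" using q by (simp add: pending_def)
  then show thesis by (rule that)
qed

text \<open>\<open>conc_closed\<close> applies to the part of the path from position
  \<open>i\<close> on, all of whose transitions are concurrent with \<open>t\<close>.\<close>

lemma discharge_pending:
  assumes path: "is_path L (fin_seq (target L) s xs)" and pend: "pending L B s xs (i, t)"
  obtains u where "(t, u) \<notin> conc L" "is_path L (fin_seq (target L) s (xs @ [u]))"
proof -
  let ?s = "end_state (target L) s (take i xs)"
  have "is_path L (fin_seq (target L) ?s (drop i xs))"
    using path is_path_fin_seq_append[of s "take i xs" "drop i xs"] by simp
  moreover have "ends_in (fin_seq (target L) ?s (drop i xs)) (end_state (target L) s xs)"
    using ends_in_fin_seq[of "target L" ?s "drop i xs"] by (simp flip: end_state_append)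
  moreover have "t \<in> active L" "first (fin_seq (target L) ?s (drop i xs)) = source L t"
    "\<And>v. v \<in> seq_transitions (fin_seq (target L) ?s (drop i xs)) \<Longrightarrow> (t, v) \<in> conc L"
    using pend by (auto simp: pending_def nonblocked_def)
  ultimately obtain u where "u \<in> active L" "source L u = end_state (target L) s xs"
    "label L u = label L t" "(t, u) \<notin> conc L"
    using conc_closed by metis
  then show thesis
    using path that by (auto simp: is_path_fin_seq_snoc active_def)
qed

lemma exists_just_extension:
  assumes countable: "\<And>s. s \<in> states L \<Longrightarrow> countable {t \<in> nonblocked L B. source L t = s}"
    and path: "is_path L (fin_seq (target L) s xs)"
  shows "\<exists>p. is_prefix (fin_seq (target L) s xs) p \<and> just L B p"
proof (cases "\<exists>ys. just L B (fin_seq (target L) s (xs @ ys))")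
  case True
  then show ?thesis using is_prefix_fin_seq[of "target L" s xs] by metis
next
  case False
  \<comment> \<open>One round of the construction: \<open>zs\<close> is the path so far,
    \<open>a\<close> the selected task, \<open>u\<close> the transition discharging it.\<close>
  define P where "P zs a u \<longleftrightarrow> pending L B s zs a \<and>
    (\<forall>b. pending L B s zs b \<longrightarrow> task_code L B a \<le> task_code L B b) \<and> (snd a, u) \<notin> conc L \<and>
    is_path L (fin_seq (target L) s (zs @ [u]))" for zs a u
  have "\<exists>a u. P (xs @ ys) a u" if zs: "is_path L (fin_seq (target L) s (xs @ ys))" for ys
  proof -
    obtain b where "pending L B s (xs @ ys) b"
      using not_just_fin_seqE[OF zs] False by metis
    from ex_has_least_nat[of "pending L B s (xs @ ys)", OF this, of "task_code L B"]
    obtain a where a: "pending L B s (xs @ ys) a"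
      "\<forall>b. pending L B s (xs @ ys) b \<longrightarrow> task_code L B a \<le> task_code L B b" by blast
    obtain i t where "a = (i, t)" by force
    with a obtain u where "(snd a, u) \<notin> conc L"
      "is_path L (fin_seq (target L) s ((xs @ ys) @ [u]))"
      using discharge_pending[OF zs, of B i t] by auto
    with a show ?thesis unfolding P_def by blast
  qed
  \<comment> \<open>Stated for the whole list \<open>zs\<close>, so that choice yields functions of
    the history.\<close>
  then have "\<exists>a u. P zs a u" if "is_path L (fin_seq (target L) s zs)" "\<exists>ys. zs = xs @ ys" for zs
    using that by blast
  then obtain a g where "P zs (a zs) (g zs)"
    if "is_path L (fin_seq (target L) s zs)" "\<exists>ys. zs = xs @ ys" for zs
    by metis
  then have ag: "P (xs @ ys) (a (xs @ ys)) (g (xs @ ys))"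
    if "is_path L (fin_seq (target L) s (xs @ ys))" for ys
    using that by blast
  define f where "f = history_rec xs g"
  define h where "h n = map f [0..<n]" for n
  let ?l = "length xs"
  have f_prefix: "f k = xs ! k" if "k < ?l" for k
    using that by (simp add: f_def history_rec.simps)
  have f_step: "f k = g (h k)" if "?l \<le> k" for k
    using that by (simp add: f_def h_def history_rec.simps[of _ _ k])
  have h_Suc: "h (Suc n) = h n @ [f n]" for n by (simp add: h_def)
  have h_length: "h ?l = xs" by (rule nth_equalityI) (auto simp: h_def f_prefix)
  have h_split: "h n = xs @ map f [?l..<n]" if "?l \<le> n" for n
    using that h_length by (metis h_def le_add_diff_inverse map_append upt_add_eq_append zero_le)
  \<comment> \<open>The choice \<open>g\<close> is only meaningful on paths, and it keeps the
    history a path; hence the induction.\<close>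
  have h_path: "is_path L (fin_seq (target L) s (h n))" if "?l \<le> n" for n
    using that
  proof (induction rule: dec_induct)
    case base
    show ?case using path by (simp add: h_length)
  next
    case (step n)
    with ag[of "map f [?l..<n]"] show ?case
      by (simp add: h_Suc f_step P_def flip: h_split)
  qed
  have selected: "P (h n) (a (h n)) (f n)" if "?l \<le> n" for n
    using ag[of "map f [?l..<n]"] h_path[OF that] that by (simp add: f_step flip: h_split)
  \<comment> \<open>Below \<open>?l\<close>, \<open>h n\<close> is an initial part of the given
    path. This covers the transitions of \<open>xs\<close> as well.\<close>
  have h_path': "is_path L (fin_seq (target L) s (h n))" for n
  proof (cases "?l \<le> n")
    case False
    then have "h ?l = h n @ map f [n..<?l]"
      by (metis h_def le_add_diff_inverse linear map_append upt_add_eq_append zero_le)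
    then show ?thesis using h_path[of ?l] by (simp add: is_path_fin_seq_append)
  qed (rule h_path)
  define st where "st n = end_state (target L) s (h n)" for n
  have f_path: "f n \<in> transitions L \<and> label L (f n) \<in> actions L \<and> source L (f n) = st n" for n
    using h_path'[of "Suc n"] by (simp add: h_Suc is_path_fin_seq_snoc st_def)
  have st_Suc: "st (Suc n) = target L (f n)" for n by (simp add: st_def h_Suc)
  have st_0: "st 0 = s" by (simp add: st_def h_def)
  have st_states: "st n \<in> states L" for n
    using f_path source_in_states by metis
  \<comment> \<open>The state at position \<open>i\<close> is \<open>st i\<close> whatever
    \<open>n\<close> is, so a discharged task stays discharged as \<open>n\<close> grows.\<close>
  have pending_h: "pending L B s (h n) (i, t) \<longleftrightarrow> i \<le> n \<and> t \<in> nonblocked L B \<and>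
      source L t = st i \<and> (\<forall>k\<in>{i..<n}. (t, f k) \<in> conc L)" for n i t
    by (auto simp: pending_def h_def st_def drop_map take_map min_def)

  let ?p = "inf_seq (source L) f 0"
  have "is_path L ?p"
    by (rule is_path_inf_seq) (use f_path st_states st_Suc in auto)
  moreover have "is_prefix (fin_seq (target L) s xs) ?p"
    by (rule is_prefix_inf_seq) (use f_path st_Suc st_0 f_prefix in auto)
  moreover have "\<exists>u \<in> seq_transitions q. (t, u) \<notin> conc L"
    if q: "is_suffix q ?p" and t: "t \<in> nonblocked L B" "source L t = first q" for q t
  proof (rule ccontr)
    assume conc: "\<not> ?thesis"
    from is_suffix_inf_seq[OF q] obtain i where i: "q = inf_seq (source L) f i" by auto
    \<comment> \<open>From \<open>i\<close> on, \<open>(i, t)\<close> is pending and bounds the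
      selected codes; from \<open>?l\<close> on, transitions are chosen by \<open>g\<close>.
      Infinitely many distinct codes below a bound are impossible.\<close>
    let ?N = "{max i ?l..}" and ?code = "\<lambda>n. task_code L B (a (h n))"
    have "(t, f k) \<in> conc L" if "i \<le> k" for k
      using conc i seq_transitions_inf_seq[OF that] by blast
    then have "pending L B s (h n) (i, t)" if "i \<le> n" for n
      using that t i f_path by (auto simp: pending_h)
    then have "?code ` ?N \<subseteq> {..task_code L B (i, t)}"
      using selected by (auto simp: P_def)
    then have "finite (?code ` ?N)" using finite_subset by blast
    moreover have "inj_on ?code ?N"
    proof (rule linorder_inj_onI)
      fix m n assume mn: "m < n" "m \<in> ?N" "n \<in> ?N"
      obtain j v where jv: "a (h m) = (j, v)" by force
      obtain j' v' where jv': "a (h n) = (j', v')" by force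
      have m: "pending L B s (h m) (j, v)" "(v, f m) \<notin> conc L"
        using selected[of m] mn jv by (auto simp: P_def)
      have n: "pending L B s (h n) (j', v')"
        using selected[of n] mn jv' by (auto simp: P_def)
      \<comment> \<open>\<open>f m\<close> discharges the task selected at \<open>m\<close>, so that
        task is no longer pending at \<open>n\<close>.\<close>
      have "(j, v) \<noteq> (j', v')" using m n mn(1) by (auto simp: pending_h)
      moreover have "countable {t' \<in> nonblocked L B. source L t' = source L v}"
        using m countable st_states by (simp add: pending_h)
      \<comment> \<open>If \<open>j = j'\<close>, both transitions leave \<open>st j\<close>, as
        \<open>task_code_eqD\<close> requires.\<close>
      ultimately show "?code m \<noteq> ?code n"
        using m n task_code_eqD[of L B j v j' v'] unfolding jv jv' pending_h by auto
    qed auto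
    ultimately show False
      using finite_imageD infinite_Ici by blast
  qed
  ultimately show ?thesis unfolding just_def by blast
qed

end

theorem theorem1:
  fixes L :: "('s, 't, 'l) ltsc" and B :: "'l set"
  assumes "lts_with_concurrency L"
    and "receptive L \<subseteq> B" and "B \<subseteq> actions L"
    and "\<And>s. s \<in> states L \<Longrightarrow> countable {t \<in> nonblocked L B. source L t = s}"
  shows "feasible L (just L B)"
proof -
  interpret lts_with_concurrency L by fact
  show ?thesis
    unfolding feasible_def finite_seq_def
    using finite_path_eq_fin_seq[of _ _ L] exists_just_extension[OF assms(4)]
    by (metis just_def)
qed

end
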